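(* Let $n\ge 2$ and let $\mathcal{A}_n$ denote the set of arc permutations in $S_n$. Then $$\sum_{\pi\in\mathcal{A}_n} q^{\mathrm{maj}(\pi)}=[n]_q \prod_{i=1}^{n-2} (1+q^{i}),\qquad \sum_{\pi\in \mathcal{A}_n} \mathrm{sign}(\pi) q^{\mathrm{maj}(\pi)}= [n]_{(-1)^{n-1}q} \prod_{i=1}^{n-2} (1+ (-q)^i).$$
   Context: An interval of $\mathbb{Z}_n$ is a set of the form $\{a,a+1,\dots,b\}$ or $\{b,b+1,\dots,n,1,2,\dots,a\}$ with $1\le a\le b\le n$. A permutation $\pi\in S_n$ is an arc permutation if for every $1\le j\le n$ the set $\{\pi(1),\dots,\pi(j)\}$ is an interval of $\mathbb{Z}_n$. For $\pi\in S_n$, $\mathrm{maj}(\pi)=\sum_{i:\pi(i)>\pi(i+1)}i$, $\mathrm{sign}(\pi)=(-1)^{\mathrm{inv}(\pi)}$ where $\mathrm{inv}(\pi)=\#\{i<j:\pi(i)>\pi(j)\}$. $[m]_q=1+q+\dots+q^{m-1}$ (so $[m]_{z}=1+z+\dots+z^{m-1}$ for any $z$). *)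

theory Defs
  imports Main "HOL-Combinatorics.Permutations"
begin

text \<open>
  The symmetric group is rendered as the functions \<open>\<pi>\<close> on the naturals with
  \<open>\<pi> permutes {1..n}\<close>, and the elements of the cyclic group of order \<open>n\<close> are represented
  by \<open>1, \<dots>, n\<close>.
\<close>

definition cyclic_interval :: "nat \<Rightarrow> nat set \<Rightarrow> bool" where
  "cyclic_interval n I \<longleftrightarrow>
     (\<exists>a b. 1 \<le> a \<and> a \<le> b \<and> b \<le> n \<and> (I = {a..b} \<or> I = {b..n} \<union> {1..a}))"

definition arc_permutations :: "nat \<Rightarrow> (nat \<Rightarrow> nat) set" where
  "arc_permutations n =
     {\<pi>. \<pi> permutes {1..n} \<and> (\<forall>j\<in>{1..n}. cyclic_interval n (\<pi> ` {1..j}))}"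

definition maj :: "nat \<Rightarrow> (nat \<Rightarrow> nat) \<Rightarrow> nat" where
  "maj n \<pi> = (\<Sum>i | 1 \<le> i \<and> i < n \<and> \<pi> i > \<pi> (i + 1). i)"

definition inv_count :: "nat \<Rightarrow> (nat \<Rightarrow> nat) \<Rightarrow> nat" where
  "inv_count n \<pi> = card {(i, j). 1 \<le> i \<and> i < j \<and> j \<le> n \<and> \<pi> i > \<pi> j}"

text \<open>
  The sign is defined through inversions, valued in an arbitrary commutative ring; the library's
  \<^const>\<open>sign\<close> is defined through transpositions instead.
\<close>

definition inv_sign :: "nat \<Rightarrow> (nat \<Rightarrow> nat) \<Rightarrow> 'a::comm_ring_1" where
  "inv_sign n \<pi> = (- 1) ^ inv_count n \<pi>"

definition q_bracket :: "nat \<Rightarrow> 'a::comm_ring_1 \<Rightarrow> 'a" where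
  "q_bracket m z = (\<Sum>i<m. z ^ i)"

end

theory Submission
  imports Defs
begin

text \<open>
  Adding 1 modulo \<open>n\<close> to the values permutes the arc permutations. If the last value is not \<open>n\<close>, it
  lowers the major index by exactly 1 and changes the inversion number by \<open>n - 1\<close> modulo 2, so the
  arc permutations with a prescribed last value have generating functions forming a geometric
  progression with ratio \<open>(\<plusminus>1)\<^sup>n\<^sup>-\<^sup>1 q\<close>; this yields the factor \<open>[n]\<close>. Those of size \<open>n + 1\<close> ending with
  \<open>n + 1\<close> are the arc permutations of size \<open>n\<close> ending with \<open>1\<close> or \<open>n\<close>, that is, the two extreme terms
  of the progression for \<open>n\<close>, which gives a recursion producing the product. A parameter \<open>s\<close> with
  \<open>s\<^sup>2 = 1\<close> treats the signed and unsigned sums at once.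
\<close>

text \<open>For \<open>n >= 1\<close> this is the n-cycle on \<open>{1..n}\<close>. The last branch
  fixes all other naturals, as \<open>permutes\<close> demands, so that composing with it keeps
  permutations of \<open>{1..n}\<close> among themselves.\<close>

definition cyclic_succ :: "nat \<Rightarrow> nat \<Rightarrow> nat" where
  "cyclic_succ n x = (if x = n then 1 else if x \<in> {1..<n} then x + 1 else x)"

definition inversions :: "nat \<Rightarrow> (nat \<Rightarrow> nat) \<Rightarrow> (nat \<times> nat) set" where
  "inversions n \<pi> = {(i, j). 1 \<le> i \<and> i < j \<and> j \<le> n \<and> \<pi> i > \<pi> j}"

definition descents :: "nat \<Rightarrow> (nat \<Rightarrow> nat) \<Rightarrow> nat set" where
  "descents n \<pi> = {i. 1 \<le> i \<and> i < n \<and> \<pi> i > \<pi> (i + 1)}"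

definition arc_weight :: "'a::comm_ring_1 \<Rightarrow> 'a \<Rightarrow> nat \<Rightarrow> (nat \<Rightarrow> nat) \<Rightarrow> 'a" where
  "arc_weight s q n \<pi> = s ^ inv_count n \<pi> * q ^ maj n \<pi>"

definition arc_permutations_ending :: "nat \<Rightarrow> nat \<Rightarrow> (nat \<Rightarrow> nat) set" where
  "arc_permutations_ending n k = {\<pi> \<in> arc_permutations n. \<pi> n = k}"

lemma inv_count_eq: "inv_count n \<pi> = card (inversions n \<pi>)"
  by (simp add: inv_count_def inversions_def)

lemma maj_eq: "maj n \<pi> = \<Sum>(descents n \<pi>)"
  by (simp add: maj_def descents_def)

lemma finite_inversions [simp]: "finite (inversions n \<pi>)"
  by (rule finite_subset[of _ "{1..n} \<times> {1..n}"]) (auto simp: inversions_def)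

lemma finite_descents [simp]: "finite (descents n \<pi>)"
  by (rule finite_subset[of _ "{1..n}"]) (auto simp: descents_def)

lemma finite_arc_permutations: "finite (arc_permutations n)"
  by (rule finite_subset[OF _ finite_permutations[of "{1..n}"]]) (auto simp: arc_permutations_def)

section \<open>Rotation of the values and its effect on the statistics\<close>

lemma cyclic_succ_permutes:
  assumes "n \<ge> 1"
  shows "cyclic_succ n permutes {1..n}"
proof (rule bij_imp_permutes)
  have "inj_on (cyclic_succ n) {1..n}"
    by (auto simp: inj_on_def cyclic_succ_def)
  moreover have "cyclic_succ n ` {1..n} \<subseteq> {1..n}"
    using assms by (auto simp: cyclic_succ_def)
  ultimately show "bij_betw (cyclic_succ n) {1..n} {1..n}"
    by (simp add: bij_betw_def endo_inj_surj)
qed (use assms in \<open>auto simp: cyclic_succ_def\<close>)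

lemma mem_image_cyclic_succ:
  assumes "I \<subseteq> {1..n}"
  shows "x \<in> cyclic_succ n ` I \<longleftrightarrow> (2 \<le> x \<and> x \<le> n \<and> x - 1 \<in> I) \<or> (x = 1 \<and> n \<in> I)"
proof
  assume "x \<in> cyclic_succ n ` I"
  then obtain y where "y \<in> I" "x = cyclic_succ n y" by blast
  then show "(2 \<le> x \<and> x \<le> n \<and> x - 1 \<in> I) \<or> (x = 1 \<and> n \<in> I)"
    using subsetD[OF assms \<open>y \<in> I\<close>] by (auto simp: cyclic_succ_def)
next
  assume "(2 \<le> x \<and> x \<le> n \<and> x - 1 \<in> I) \<or> (x = 1 \<and> n \<in> I)"
  then show "x \<in> cyclic_succ n ` I"
  proof
    assume "2 \<le> x \<and> x \<le> n \<and> x - 1 \<in> I"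
    then show ?thesis by (intro image_eqI[of _ _ "x - 1"]) (auto simp: cyclic_succ_def)
  next
    assume "x = 1 \<and> n \<in> I"
    then show ?thesis by (intro image_eqI[of _ _ n]) (auto simp: cyclic_succ_def)
  qed
qed

lemma cyclic_intervalI:
  assumes "1 \<le> a" "a \<le> b" "b \<le> n" "I = {a..b} \<or> I = {b..n} \<union> {1..a}"
  shows "cyclic_interval n I"
  using assms unfolding cyclic_interval_def by blast

text \<open>Rotating an arc gives an arc of the same length. The work lies in the ends: the normal
  form of the image depends on whether \<open>n\<close> wraps around to 1 and whether
  \<open>a\<close> can still be increased.\<close>

lemma cyclic_interval_image_cyclic_succ:
  assumes "cyclic_interval n I"
  shows "cyclic_interval n (cyclic_succ n ` I)"
proof -
  obtain a b where ab: "1 \<le> a" "a \<le> b" "b \<le> n" and I: "I = {a..b} \<or> I = {b..n} \<union> {1..a}"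
    using assms unfolding cyclic_interval_def by blast
  have sub: "I \<subseteq> {1..n}" using ab I by auto
  note shift = mem_image_cyclic_succ[OF sub]
  from I show ?thesis
  proof
    assume I: "I = {a..b}"
    \<comment> \<open>Respectively: nothing wraps; only the right end wraps, giving an arc through
      \<open>n\<close> and 1; the singleton \<open>{n}\<close> becomes \<open>{1}\<close>.\<close>
    consider "b < n" | "b = n" "a < n" | "a = n" "b = n" using ab by linarith
    then show ?thesis
    proof cases
      case 1
      then have "cyclic_succ n ` I = {a+1..b+1}"
        unfolding set_eq_iff shift using I ab by auto
      then show ?thesis using 1 ab by (intro cyclic_intervalI[of "a+1" "b+1"]) auto
    next
      case 2
      then have "cyclic_succ n ` I = {a+1..n} \<union> {1..1}"
        unfolding set_eq_iff shift using I ab by auto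
      then show ?thesis using 2 ab by (intro cyclic_intervalI[of 1 "a+1"]) auto
    next
      case 3
      then have "cyclic_succ n ` I = {1..1}"
        unfolding set_eq_iff shift using I ab by auto
      then show ?thesis using 3 ab by (intro cyclic_intervalI[of 1 1]) auto
    qed
  next
    assume I: "I = {b..n} \<union> {1..a}"
    \<comment> \<open>Respectively: the gap between \<open>a\<close> and \<open>b\<close> moves up
      by one; the arc starting at \<open>n\<close> becomes an initial segment; the arc is the whole
      cycle.\<close>
    consider "b < n" | "b = n" "a < n" | "a = n" "b = n" using ab by linarith
    then show ?thesis
    proof cases
      case 1
      then have "cyclic_succ n ` I = {b+1..n} \<union> {1..a+1}"
        unfolding set_eq_iff shift using I ab by auto
      then show ?thesis using 1 ab by (intro cyclic_intervalI[of "a+1" "b+1"]) auto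
    next
      case 2
      then have "cyclic_succ n ` I = {1..a+1}"
        unfolding set_eq_iff shift using I ab by auto
      then show ?thesis using 2 ab by (intro cyclic_intervalI[of 1 "a+1"]) auto
    next
      case 3
      then have "cyclic_succ n ` I = {1..n}"
        unfolding set_eq_iff shift using I ab by auto
      then show ?thesis using 3 ab by (intro cyclic_intervalI[of 1 n]) auto
    qed
  qed
qed

text \<open>Taking prefix images commutes with rotation, so arcs stay arcs. Finiteness then upgrades
  an injective self-map to a bijection, and no inverse rotation has to be studied.\<close>

lemma bij_betw_comp_cyclic_succ:
  assumes "n \<ge> 1"
  shows "bij_betw ((\<circ>) (cyclic_succ n)) (arc_permutations n) (arc_permutations n)"
proof -
  have perm: "cyclic_succ n permutes {1..n}"
    using assms by (rule cyclic_succ_permutes)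
  have "inj_on ((\<circ>) (cyclic_succ n)) (arc_permutations n)"
    by (rule inj_on_subset[OF fun.inj_map[OF permutes_inj[OF perm]]]) simp
  moreover have "cyclic_succ n \<circ> \<pi> \<in> arc_permutations n" if "\<pi> \<in> arc_permutations n" for \<pi>
    using that perm unfolding arc_permutations_def mem_Collect_eq image_comp[symmetric]
    by (simp add: permutes_compose cyclic_interval_image_cyclic_succ)
  then have "(\<circ>) (cyclic_succ n) ` arc_permutations n \<subseteq> arc_permutations n"
    by blast
  ultimately show ?thesis
    by (simp add: bij_betw_def endo_inj_surj finite_arc_permutations)
qed

lemma bij_betw_ending_Suc:
  assumes "1 \<le> k" "k < n"
  shows "bij_betw ((\<circ>) (cyclic_succ n)) (arc_permutations_ending n k)
           (arc_permutations_ending n (Suc k))"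
proof -
  have bij: "bij_betw ((\<circ>) (cyclic_succ n)) (arc_permutations n) (arc_permutations n)"
    using assms by (intro bij_betw_comp_cyclic_succ) auto
  have "cyclic_succ n (\<pi> n) = Suc k \<longleftrightarrow> \<pi> n = k" for \<pi>
    using assms by (auto simp: cyclic_succ_def)
  then have "(\<circ>) (cyclic_succ n) ` arc_permutations_ending n k
      = {\<tau> \<in> (\<circ>) (cyclic_succ n) ` arc_permutations n. \<tau> n = Suc k}"
    by (auto simp: arc_permutations_ending_def)
  then have "(\<circ>) (cyclic_succ n) ` arc_permutations_ending n k
      = arc_permutations_ending n (Suc k)"
    using bij by (simp add: bij_betw_def arc_permutations_ending_def)
  moreover have "arc_permutations_ending n k \<subseteq> arc_permutations n"
    by (auto simp: arc_permutations_ending_def)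
  ultimately show ?thesis
    by (simp add: bij_betw_subset[OF bij])
qed

text \<open>Rotation turns the largest value, at position \<open>i\<close>, into the smallest and
  keeps the relative order of all others, so only comparisons with position \<open>i\<close> change.
  The descent at \<open>i\<close> moves to \<open>i - 1\<close>; the \<open>n - i\<close> inversions
  to the right of \<open>i\<close> vanish and \<open>i - 1\<close> new ones appear to its left. The
  second equation is additive to avoid truncated subtraction.\<close>

lemma statistics_comp_cyclic_succ:
  assumes \<pi>: "\<pi> permutes {1..n}" and i: "1 \<le> i" "i < n" "\<pi> i = n"
  shows "maj n \<pi> = Suc (maj n (cyclic_succ n \<circ> \<pi>))"
    and "inv_count n (cyclic_succ n \<circ> \<pi>) + (n - i) = inv_count n \<pi> + (i - 1)"
proof -
  have range: "1 \<le> \<pi> x \<and> \<pi> x < n" if "1 \<le> x" "x \<le> n" "x \<noteq> i" for x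
  proof -
    have "\<pi> x \<noteq> \<pi> i" using permutes_inj[OF \<pi>] that by (auto dest: injD)
    moreover have "\<pi> x \<in> {1..n}" using permutes_in_image[OF \<pi>] that by auto
    ultimately show ?thesis using i by auto
  qed
  have val: "(cyclic_succ n \<circ> \<pi>) x = \<pi> x + 1" if "1 \<le> x" "x \<le> n" "x \<noteq> i" for x
    using range[OF that] by (auto simp: cyclic_succ_def)
  have vali: "(cyclic_succ n \<circ> \<pi>) i = 1"
    using i by (simp add: cyclic_succ_def)
  \<comment> \<open>The descents whose two positions both differ from \<open>i\<close>: the part
    common to both permutations.\<close>
  define D where "D = {j. 1 \<le> j \<and> j < n \<and> j \<noteq> i \<and> j + 1 \<noteq> i \<and> \<pi> j > \<pi> (j + 1)}"
  have D: "finite D" "i \<notin> D" "i - 1 \<notin> D" "0 \<notin> D"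
    using i by (auto simp: D_def)
  have d1: "descents n \<pi> = insert i D"
  proof (intro set_eqI)
    fix x
    consider "\<not> (1 \<le> x \<and> x < n)" | "1 \<le> x" "x < n" "x = i" | "1 \<le> x" "x < n" "x + 1 = i"
      | "1 \<le> x" "x < n" "x \<noteq> i" "x + 1 \<noteq> i" by linarith
    then show "x \<in> descents n \<pi> \<longleftrightarrow> x \<in> insert i D"
    proof cases
      case 2
      then show ?thesis using range[of "i + 1"] i by (simp add: descents_def)
    next
      case 3
      then show ?thesis using range[of x] i by (auto simp: descents_def D_def)
    qed (use i in \<open>auto simp: descents_def D_def\<close>)
  qed
  \<comment> \<open>If \<open>i = 1\<close>, the moved descent would sit at position 0, which is not
    a descent. Inserting 0 on both sides covers this case uniformly and leaves the sums
    unchanged.\<close>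
  have d2: "insert 0 (descents n (cyclic_succ n \<circ> \<pi>)) = insert 0 (insert (i - 1) D)"
  proof (intro set_eqI)
    fix x
    consider "x = 0" | "x \<ge> n" | "1 \<le> x" "x < n" "x = i" | "1 \<le> x" "x < n" "x + 1 = i"
      | "1 \<le> x" "x < n" "x \<noteq> i" "x + 1 \<noteq> i" by linarith
    then show "x \<in> insert 0 (descents n (cyclic_succ n \<circ> \<pi>)) \<longleftrightarrow> x \<in> insert 0 (insert (i - 1) D)"
    proof cases
      case 3
      then show ?thesis using vali val[of "i+1"] i by (auto simp: descents_def D_def simp del: o_apply)
    next
      case 4
      then show ?thesis using vali val[of x] range[of x] i
        by (auto simp: descents_def D_def simp del: o_apply)
    next
      case 5
      then show ?thesis using val[of x] val[of "x+1"] i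
        by (auto simp: descents_def D_def simp del: o_apply)
    qed (use i in \<open>auto simp: descents_def D_def\<close>)
  qed
  have "maj n (cyclic_succ n \<circ> \<pi>) = \<Sum>(insert 0 (descents n (cyclic_succ n \<circ> \<pi>)))"
    by (simp add: maj_eq sum.insert_if)
  also have "\<dots> = \<Sum>D + (i - 1)"
    unfolding d2 using D i by (simp add: sum.insert_if add.commute)
  finally show "maj n \<pi> = Suc (maj n (cyclic_succ n \<circ> \<pi>))"
    using D i by (simp add: maj_eq d1)
  \<comment> \<open>The inversions not involving position \<open>i\<close>, again common to both
    permutations.\<close>
  define R where "R = {(x, y) \<in> inversions n \<pi>. x \<noteq> i \<and> y \<noteq> i}"
  have R: "finite R" by (rule finite_subset[OF _ finite_inversions[of n \<pi>]]) (auto simp: R_def)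
  have r1: "inversions n \<pi> = R \<union> {i} \<times> {i+1..n}"
  proof (intro set_eqI, clarify)
    fix x y
    consider "\<not> (1 \<le> x \<and> x < y \<and> y \<le> n)" | "1 \<le> x" "x < y" "y \<le> n" "x = i"
      | "1 \<le> x" "x < y" "y \<le> n" "y = i" | "1 \<le> x" "x < y" "y \<le> n" "x \<noteq> i" "y \<noteq> i" by linarith
    then show "(x, y) \<in> inversions n \<pi> \<longleftrightarrow> (x, y) \<in> R \<union> {i} \<times> {i+1..n}"
    proof cases
      case 2
      then show ?thesis using range[of y] i by (simp add: inversions_def)
    next
      case 3
      then show ?thesis using range[of x] i by (auto simp: inversions_def R_def)
    qed (use i in \<open>auto simp: inversions_def R_def\<close>)
  qed
  have r2: "inversions n (cyclic_succ n \<circ> \<pi>) = R \<union> {1..<i} \<times> {i}"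
  proof (intro set_eqI, clarify)
    fix x y
    consider "\<not> (1 \<le> x \<and> x < y \<and> y \<le> n)" | "1 \<le> x" "x < y" "y \<le> n" "x = i"
      | "1 \<le> x" "x < y" "y \<le> n" "y = i" | "1 \<le> x" "x < y" "y \<le> n" "x \<noteq> i" "y \<noteq> i" by linarith
    then show "(x, y) \<in> inversions n (cyclic_succ n \<circ> \<pi>) \<longleftrightarrow> (x, y) \<in> R \<union> {1..<i} \<times> {i}"
    proof cases
      case 2
      then show ?thesis using vali val[of y] i by (auto simp: inversions_def R_def simp del: o_apply)
    next
      case 3
      then show ?thesis using vali val[of x] range[of x] i
        by (auto simp: inversions_def R_def simp del: o_apply)
    next
      case 4
      then show ?thesis using val[of x] val[of y] i
        by (auto simp: inversions_def R_def simp del: o_apply)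
    qed (use i in \<open>auto simp: inversions_def R_def\<close>)
  qed
  have "card (inversions n \<pi>) = card R + (n - i)"
    unfolding r1 using R by (subst card_Un_disjoint) (auto simp: R_def card_cartesian_product)
  moreover have "card (inversions n (cyclic_succ n \<circ> \<pi>)) = card R + (i - 1)"
    unfolding r2 using R by (subst card_Un_disjoint) (auto simp: R_def card_cartesian_product)
  ultimately show "inv_count n (cyclic_succ n \<circ> \<pi>) + (n - i) = inv_count n \<pi> + (i - 1)"
    by (simp add: inv_count_eq)
qed

section \<open>Weights by last value: the geometric progression\<close>

lemma power_parity_cong:
  fixes s :: "'a::comm_ring_1"
  assumes "s * s = 1" "even (a + b)"
  shows "s ^ a = s ^ b"
proof -
  have sq: "s ^ 2 = 1" using assms by (simp add: power2_eq_square)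
  have "s ^ m = s ^ (m mod 2)" for m :: nat
    by (metis div_mult_mod_eq mult_1 power_add power_mult power_one mult.commute sq)
  moreover have "a mod 2 = b mod 2"
    using assms by presburger
  ultimately show ?thesis by metis
qed

lemma arc_weight_comp_cyclic_succ:
  fixes s q :: "'a::comm_ring_1"
  assumes "s * s = 1" "\<pi> permutes {1..n}" "n \<ge> 1" "\<pi> n \<noteq> n"
  shows "arc_weight s q n \<pi> = s ^ (n - 1) * q * arc_weight s q n (cyclic_succ n \<circ> \<pi>)"
proof -
  obtain i where i: "i \<in> {1..n}" "\<pi> i = n"
    using permutes_image[OF assms(2)] assms(3) by (metis atLeastAtMost_iff image_iff le_refl)
  then have "1 \<le> i" "i < n"
    using assms(4) by (auto simp: le_less)
  note stats = statistics_comp_cyclic_succ[OF assms(2) this i(2)]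
  \<comment> \<open>The two inversion numbers differ by \<open>n - 1\<close> modulo 2, whatever
    \<open>i\<close> is. Writing the sum as an explicit double lets \<open>power_parity_cong\<close>
    apply.\<close>
  have "inv_count n \<pi> + (n - 1 + inv_count n (cyclic_succ n \<circ> \<pi>))
      = 2 * (inv_count n (cyclic_succ n \<circ> \<pi>) + (n - i))"
    using stats(2) \<open>1 \<le> i\<close> \<open>i < n\<close> by arith
  then have "s ^ inv_count n \<pi> = s ^ (n - 1 + inv_count n (cyclic_succ n \<circ> \<pi>))"
    by (intro power_parity_cong[OF assms(1)]) (simp only: dvd_triv_left)
  then show ?thesis
    by (simp add: arc_weight_def stats(1) power_add mult_ac)
qed

text \<open>Raising the last value from \<open>k\<close> to \<open>n\<close> takes
  \<open>n - k\<close> rotations, each contributing one factor; hence the induction runs downwards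
  from \<open>k = n\<close>.\<close>

lemma sum_arc_permutations_ending:
  fixes s q :: "'a::comm_ring_1"
  assumes "s * s = 1" "1 \<le> k" "k \<le> n"
  shows "sum (arc_weight s q n) (arc_permutations_ending n k)
           = (s ^ (n - 1) * q) ^ (n - k) * sum (arc_weight s q n) (arc_permutations_ending n n)"
  using assms(3,2)
proof (induction k rule: inc_induct)
  case base
  then show ?case by simp
next
  case (step k)
  have "sum (arc_weight s q n) (arc_permutations_ending n k)
      = (\<Sum>\<pi>\<in>arc_permutations_ending n k.
           s ^ (n - 1) * q * arc_weight s q n (cyclic_succ n \<circ> \<pi>))"
    using step by (intro sum.cong refl arc_weight_comp_cyclic_succ assms(1))
      (auto simp: arc_permutations_ending_def arc_permutations_def)
  also have "\<dots> = s ^ (n - 1) * q * sum (arc_weight s q n) (arc_permutations_ending n (Suc k))"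
    using sum.reindex_bij_betw[OF bij_betw_ending_Suc[of k n], of "arc_weight s q n"] step
    by (simp add: sum_distrib_left[symmetric])
  also have "\<dots> = (s ^ (n - 1) * q) ^ Suc (n - Suc k)
      * sum (arc_weight s q n) (arc_permutations_ending n n)"
    using step by (simp add: mult_ac)
  finally show ?case
    using step by (simp add: Suc_diff_Suc)
qed

lemma sum_arc_permutations_by_last:
  fixes s q :: "'a::comm_ring_1"
  assumes "s * s = 1" "n \<ge> 1"
  shows "sum (arc_weight s q n) (arc_permutations n)
           = q_bracket n (s ^ (n - 1) * q) * sum (arc_weight s q n) (arc_permutations_ending n n)"
proof -
  have "\<pi> n \<in> {1..n}" if "\<pi> \<in> arc_permutations n" for \<pi>
    using permutes_in_image[of \<pi> "{1..n}" n] that assms(2) by (auto simp: arc_permutations_def)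
  then have "(\<lambda>\<pi>. \<pi> n) ` arc_permutations n \<subseteq> {1..n}"
    by blast
  then have "sum (arc_weight s q n) (arc_permutations n)
      = (\<Sum>k\<in>{1..n}. sum (arc_weight s q n) (arc_permutations_ending n k))"
    unfolding arc_permutations_ending_def
    by (intro sum.group[symmetric] finite_arc_permutations) auto
  also have "\<dots> = (\<Sum>k\<in>{1..n}. (s ^ (n - 1) * q) ^ (n - k))
      * sum (arc_weight s q n) (arc_permutations_ending n n)"
    unfolding sum_distrib_right
    by (intro sum.cong refl sum_arc_permutations_ending assms(1)) auto
  \<comment> \<open>The exponents \<open>n - k\<close> run through \<open>0, ..., n - 1\<close> in
    reverse order.\<close>
  also have "(\<Sum>k\<in>{1..n}. (s ^ (n - 1) * q) ^ (n - k)) = q_bracket n (s ^ (n - 1) * q)"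
    unfolding q_bracket_def
    by (rule sum.reindex_bij_witness[of _ "\<lambda>i. n - i" "\<lambda>k. n - k"]) auto
  finally show ?thesis .
qed

section \<open>The recursion in n and the product formula\<close>

lemma arc_permutations_ending_Suc:
  assumes "n \<ge> 2"
  shows "arc_permutations_ending (Suc n) (Suc n)
           = arc_permutations_ending n n \<union> arc_permutations_ending n 1"
proof (intro set_eqI iffI)
  \<comment> \<open>Prefixes of length at most \<open>n\<close> avoid \<open>Suc n\<close>, which
    every wrapped arc of the larger cycle contains, so they are ordinary intervals in
    \<open>{1..n}\<close>.\<close>
  fix \<pi> assume "\<pi> \<in> arc_permutations_ending (Suc n) (Suc n)"
  then have p: "\<pi> permutes {1..Suc n}" and last: "\<pi> (Suc n) = Suc n"
    and arc: "\<And>j. j \<in> {1..Suc n} \<Longrightarrow> cyclic_interval (Suc n) (\<pi> ` {1..j})"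
    by (auto simp: arc_permutations_ending_def arc_permutations_def)
  have p': "\<pi> permutes {1..n}"
    by (rule permutes_superset[OF p]) (auto simp: last le_Suc_eq)
  have interval: "\<exists>a b. 1 \<le> a \<and> a \<le> b \<and> b \<le> n \<and> \<pi> ` {1..j} = {a..b}" if j: "j \<in> {1..n}" for j
  proof -
    have sub: "\<pi> ` {1..j} \<subseteq> {1..n}"
      using permutes_image[OF p'] j by (metis atLeastAtMost_iff image_mono atLeastatMost_subset_iff le_refl)
    obtain a b where ab: "1 \<le> a" "a \<le> b" "b \<le> Suc n"
        "\<pi> ` {1..j} = {a..b} \<or> \<pi> ` {1..j} = {b..Suc n} \<union> {1..a}"
      using arc[of j] j unfolding cyclic_interval_def by auto
    have "Suc n \<notin> \<pi> ` {1..j}" using sub by auto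
    then have "\<pi> ` {1..j} = {a..b}" using ab by auto
    moreover from this have "b \<le> n" using sub ab by auto
    ultimately show ?thesis using ab by blast
  qed
  then have "\<pi> \<in> arc_permutations n"
    using p' unfolding arc_permutations_def cyclic_interval_def by blast
  moreover have "\<pi> n = 1 \<or> \<pi> n = n"
  proof (rule ccontr)
    assume neq: "\<not> ?thesis"
    \<comment> \<open>The prefix of length \<open>n - 1\<close> omits only the value
      \<open>\<pi> n\<close>. Deleting an interior point from \<open>{1..n}\<close> does not leave
      an interval.\<close>
    have "n - 1 \<in> {1..n}" using assms by auto
    then obtain a b where ab: "\<pi> ` {1..n-1} = {a..b}"
      using interval by blast
    have "{1..n-1} = {1..n} - {n}" using assms by auto
    then have "{a..b} = {1..n} - {\<pi> n}"
      using ab permutes_image[OF p'] permutes_inj[OF p'] by (simp add: image_set_diff)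
    moreover have "\<pi> n \<in> {1..n}" using permutes_in_image[OF p'] assms by auto
    ultimately have "1 \<in> {a..b}" "n \<in> {a..b}" "\<pi> n \<notin> {a..b}" "\<pi> n \<in> {1..n}"
      using neq assms by auto
    then show False by auto
  qed
  ultimately show "\<pi> \<in> arc_permutations_ending n n \<union> arc_permutations_ending n 1"
    by (auto simp: arc_permutations_ending_def)
next
  \<comment> \<open>A wrapped arc of the smaller cycle contains both 1 and \<open>n\<close>. A
    prefix shorter than \<open>n\<close> omits \<open>\<pi> n\<close>, which is one of these two, so
    it is an ordinary interval and remains an arc in the larger cycle.\<close>
  fix \<pi> assume "\<pi> \<in> arc_permutations_ending n n \<union> arc_permutations_ending n 1"
  then have p: "\<pi> permutes {1..n}" and last: "\<pi> n = 1 \<or> \<pi> n = n"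
    and arc: "\<And>j. j \<in> {1..n} \<Longrightarrow> cyclic_interval n (\<pi> ` {1..j})"
    by (auto simp: arc_permutations_ending_def arc_permutations_def)
  have p': "\<pi> permutes {1..Suc n}"
    by (rule permutes_subset[OF p]) auto
  have "cyclic_interval (Suc n) (\<pi> ` {1..j})" if j: "j \<in> {1..Suc n}" for j
  proof -
    consider "j = Suc n" | "j = n" | "1 \<le> j" "j < n" using j by force
    then show ?thesis
    proof cases
      case 1
      then show ?thesis
        using permutes_image[OF p'] by (intro cyclic_intervalI[of 1 "Suc n"]) auto
    next
      case 2
      then show ?thesis
        using permutes_image[OF p] assms by (intro cyclic_intervalI[of 1 n]) auto
    next
      case 3
      then obtain a b where ab: "1 \<le> a" "a \<le> b" "b \<le> n"
          "\<pi> ` {1..j} = {a..b} \<or> \<pi> ` {1..j} = {b..n} \<union> {1..a}"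
        using arc[of j] unfolding cyclic_interval_def by auto
      have "\<pi> n \<notin> \<pi> ` {1..j}"
        using permutes_inj[OF p] 3 by (simp add: inj_image_mem_iff)
      then have "\<pi> ` {1..j} = {a..b}" using ab last by auto
      then show ?thesis using ab by (intro cyclic_intervalI[of a b]) auto
    qed
  qed
  moreover have "\<pi> (Suc n) = Suc n"
    using permutes_not_in[OF p] by simp
  ultimately show "\<pi> \<in> arc_permutations_ending (Suc n) (Suc n)"
    using p' by (simp add: arc_permutations_ending_def arc_permutations_def)
qed

text \<open>The fixed value \<open>Suc n\<close> in the last position exceeds all earlier values, so
  it creates neither a descent nor an inversion.\<close>

lemma arc_weight_Suc:
  assumes "\<pi> permutes {1..n}"
  shows "arc_weight s q (Suc n) \<pi> = arc_weight s q n \<pi>"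
proof -
  have last: "\<pi> (Suc n) = Suc n"
    using permutes_not_in[OF assms] by simp
  have le: "\<pi> i \<le> n" if "1 \<le> i" "i \<le> n" for i
    using permutes_in_image[OF assms, of i] that by simp
  have "i \<in> descents (Suc n) \<pi> \<longleftrightarrow> i \<in> descents n \<pi>" for i
    using last le[of i] by (cases "i = n") (auto simp: descents_def)
  moreover have "(i, j) \<in> inversions (Suc n) \<pi> \<longleftrightarrow> (i, j) \<in> inversions n \<pi>" for i j
    using last le[of i] by (cases "j = Suc n") (auto simp: inversions_def)
  ultimately have "descents (Suc n) \<pi> = descents n \<pi>" "inversions (Suc n) \<pi> = inversions n \<pi>"
    by auto
  then show ?thesis
    by (simp add: arc_weight_def maj_eq inv_count_eq)
qed

lemma arc_permutations_ending_2: "arc_permutations_ending 2 2 = {id}"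
proof -
  have "\<pi> = id" if "\<pi> permutes {1..2}" "\<pi> 2 = 2" for \<pi> :: "nat \<Rightarrow> nat"
  proof -
    have "\<pi> permutes {1}"
      by (rule permutes_superset[OF that(1)]) (use that(2) in \<open>auto simp: le_less numeral_2_eq_2 less_Suc_eq\<close>)
    then show ?thesis by simp
  qed
  moreover have "id \<in> arc_permutations 2"
    by (auto simp: arc_permutations_def permutes_id intro!: cyclic_intervalI[of 1])
  ultimately show ?thesis
    by (auto simp: arc_permutations_ending_def arc_permutations_def)
qed

lemma sum_arc_permutations_ending_self:
  fixes s q :: "'a::comm_ring_1"
  assumes "s * s = 1" "n \<ge> 2"
  shows "sum (arc_weight s q n) (arc_permutations_ending n n) = (\<Prod>i=1..n-2. 1 + (s * q) ^ i)"
  using assms(2)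
proof (induction n rule: dec_induct)
  case base
  have "descents 2 id = {}" "inversions 2 id = {}"
    by (auto simp: descents_def inversions_def)
  then show ?case
    by (simp add: arc_permutations_ending_2 arc_weight_def maj_eq inv_count_eq id_def)
next
  case (step n)
  let ?F = "\<lambda>k. sum (arc_weight s q n) (arc_permutations_ending n k)"
  have fin: "finite (arc_permutations_ending n k)" for k
    using finite_arc_permutations by (simp add: arc_permutations_ending_def)
  have disj: "arc_permutations_ending n n \<inter> arc_permutations_ending n 1 = {}"
    using step by (auto simp: arc_permutations_ending_def)
  have "sum (arc_weight s q (Suc n)) (arc_permutations_ending (Suc n) (Suc n))
      = sum (arc_weight s q n) (arc_permutations_ending n n \<union> arc_permutations_ending n 1)"
    unfolding arc_permutations_ending_Suc[OF step(1)]
    by (intro sum.cong refl arc_weight_Suc)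
      (auto simp: arc_permutations_ending_def arc_permutations_def)
  also have "\<dots> = ?F n + ?F 1"
    using fin disj by (rule sum.union_disjoint[OF _ fin])
  also have "?F 1 = (s ^ (n - 1) * q) ^ (n - 1) * ?F n"
    using step by (intro sum_arc_permutations_ending assms(1)) auto
  \<comment> \<open>The exponent of \<open>s\<close> is the square of \<open>n - 1\<close>, which
    has the parity of \<open>n - 1\<close>.\<close>
  also have "(s ^ (n - 1) * q) ^ (n - 1) = (s * q) ^ (n - 1)"
    unfolding power_mult_distrib power_mult[symmetric]
    by (subst power_parity_cong[OF assms(1), of _ "n - 1"]) auto
  also have "?F n + (s * q) ^ (n - 1) * ?F n = ?F n * (1 + (s * q) ^ (n - 1))"
    by (simp add: algebra_simps)
  also have "\<dots> = (\<Prod>i=1..Suc n-2. 1 + (s * q) ^ i)"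
  proof -
    \<comment> \<open>Since \<open>n >= 2\<close>, the new factor is exactly the one appended at the
      upper end of the product.\<close>
    have "Suc n - 2 = Suc (n - 2)" "n - 1 = Suc (n - 2)" using step by auto
    then show ?thesis using step by simp
  qed
  finally show ?case .
qed

theorem theorem2p6:
  fixes n :: nat and q :: "'a::comm_ring_1"
  assumes "n \<ge> 2"
  shows "(\<Sum>\<pi>\<in>arc_permutations n. q ^ maj n \<pi>)
           = q_bracket n q * (\<Prod>i=1..n-2. 1 + q ^ i)
       \<and> (\<Sum>\<pi>\<in>arc_permutations n. inv_sign n \<pi> * q ^ maj n \<pi>)
           = q_bracket n ((- 1) ^ (n - 1) * q) * (\<Prod>i=1..n-2. 1 + (- q) ^ i)"
proof -
  have main: "(\<Sum>\<pi>\<in>arc_permutations n. s ^ inv_count n \<pi> * q ^ maj n \<pi>)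
      = q_bracket n (s ^ (n - 1) * q) * (\<Prod>i=1..n-2. 1 + (s * q) ^ i)" if "s * s = 1" for s
    using sum_arc_permutations_by_last[OF that, of n q] sum_arc_permutations_ending_self[OF that assms]
      assms by (simp add: arc_weight_def)
  show ?thesis
    using main[of 1] main[of "- 1"] by (simp add: inv_sign_def)
qed

end
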